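(* Let $k$ be a positive integer and let $M$ be a matroid whose ground set has size $2k$. Then \[\pi_{k,k}(M)\ge\left(1+\frac{1}{k}\right)\pi_{k-1,k+1}(M).\]
   Context: For a matroid $N$ on a ground set $Y$ and nonnegative integers $i,j$ with $i+j=|Y|$, an independent $(i,j)$-partition of $N$ is an ordered pair $(A,B)$ with $A\cup B=Y$, $A\cap B=\emptyset$, both $A$ and $B$ independent in $N$, $|A|=i$ and $|B|=j$; $\pi_{i,j}(N)$ denotes the number of independent $(i,j)$-partitions of $N$. *)

theory Defs
  imports Complex_Main
begin

locale matroid =
  fixes ground :: "'a set" and indep :: "'a set \<Rightarrow> bool"
  assumes ground_finite: "finite ground"
    and indep_subset_ground: "indep X \<Longrightarrow> X \<subseteq> ground"
    and indep_empty: "indep {}"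
    and indep_subset: "indep X \<Longrightarrow> Y \<subseteq> X \<Longrightarrow> indep Y"
    and augment: "indep X \<Longrightarrow> indep Y \<Longrightarrow> card X < card Y \<Longrightarrow> \<exists>y\<in>Y - X. indep (insert y X)"

definition indep_partitions ::
    "'a set \<Rightarrow> ('a set \<Rightarrow> bool) \<Rightarrow> nat \<Rightarrow> nat \<Rightarrow> ('a set \<times> 'a set) set" where
  "indep_partitions Y indep i j =
     {(A, B). A \<union> B = Y \<and> A \<inter> B = {} \<and> indep A \<and> indep B \<and> card A = i \<and> card B = j}"

definition num_indep_partitions :: "'a set \<Rightarrow> ('a set \<Rightarrow> bool) \<Rightarrow> nat \<Rightarrow> nat \<Rightarrow> nat" where
  "num_indep_partitions Y indep i j = card (indep_partitions Y indep i j)"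

end

theory Submission
  imports Defs "HOL-Analysis.Function_Topology" "HOL-Analysis.Convex" "HOL-Library.Multiset"
begin

text \<open>Let \<open>n = 2k\<close> and \<open>F(x, w) = \<Sum>\<^sub>I x\<^bsup>n - |I|\<^esup> w\<^sup>I\<close>, the sum over the independent sets. Both \<open>F\<close> and the
  product \<open>F(x, w) F(y, u)\<close> are Lorentzian, and applying all operators \<open>\<partial>/\<partial>w\<^sub>e + \<partial>/\<partial>u\<^sub>e\<close> preserves this
  and leaves (at \<open>w = u = 0\<close>) the form \<open>\<Sum>\<^sub>i \<pi>\<^bsub>i,n-i\<^esub> x\<^bsup>n - i\<^esup> y\<^sup>i\<close>. Its derivative by \<open>x\<^bsup>k-1\<^esup> y\<^bsup>k-1\<^esup>\<close> is a binary
  quadratic form with equal diagonal coefficients, by the symmetry of \<open>\<pi>\<close>; having at most one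
  positive eigenvalue, it satisfies \<open>(k+1)! (k-1)! \<pi>\<^bsub>k-1,k+1\<^esub> \<le> k! k! \<pi>\<^bsub>k,k\<^esub>\<close>.\<close>

section \<open>Quadratic forms with at most one positive eigenvalue\<close>

definition bil :: "'v set \<Rightarrow> ('v \<Rightarrow> 'v \<Rightarrow> real) \<Rightarrow> ('v \<Rightarrow> real) \<Rightarrow> ('v \<Rightarrow> real) \<Rightarrow> real" where
  "bil V A u p = (\<Sum>i\<in>V. \<Sum>j\<in>V. A i j * u i * p j)"

text \<open>Reversed Cauchy-Schwarz: for symmetric \<open>A\<close> it says that there is at most
  one positive eigenvalue. In this form it passes to restrictions and limits without spectral
  theory.\<close>

definition lorentzian :: "'v set \<Rightarrow> ('v \<Rightarrow> 'v \<Rightarrow> real) \<Rightarrow> bool" where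
  "lorentzian V A \<longleftrightarrow>
     (\<forall>u p. 0 < bil V A p p \<longrightarrow> bil V A u u * bil V A p p \<le> (bil V A u p)\<^sup>2)"

lemma bil_add_left: "bil V A (\<lambda>i. u i + p i) q = bil V A u q + bil V A p q"
  by (simp add: bil_def algebra_simps sum.distrib)

lemma bil_add_right: "bil V A q (\<lambda>i. u i + p i) = bil V A q u + bil V A q p"
  by (simp add: bil_def algebra_simps sum.distrib)

lemma bil_scale_left: "bil V A (\<lambda>i. a * u i) q = a * bil V A u q"
  by (simp add: bil_def sum_distrib_left mult_ac)

lemma bil_scale_right: "bil V A q (\<lambda>i. a * u i) = a * bil V A q u"
  by (simp add: bil_def sum_distrib_left mult_ac)

lemmas bil_linear = bil_add_left bil_add_right bil_scale_left bil_scale_right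

lemma bil_sym:
  assumes "\<And>i j. i \<in> V \<Longrightarrow> j \<in> V \<Longrightarrow> A i j = A j i"
  shows "bil V A u p = bil V A p u"
proof -
  have "bil V A u p = (\<Sum>j\<in>V. \<Sum>i\<in>V. A i j * u i * p j)"
    unfolding bil_def by (rule sum.swap)
  also have "\<dots> = bil V A p u"
    unfolding bil_def using assms by (intro sum.cong refl) (simp add: mult_ac)
  finally show ?thesis .
qed

lemma bil_cong:
  assumes "\<And>i j. i \<in> V \<Longrightarrow> j \<in> V \<Longrightarrow> A i j = B i j"
    and "\<And>i. i \<in> V \<Longrightarrow> u i = u' i" and "\<And>i. i \<in> V \<Longrightarrow> p i = p' i"
  shows "bil V A u p = bil V B u' p'"
  unfolding bil_def by (intro sum.cong refl) (simp only: assms)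

lemma bil_row: "bil V A u p = (\<Sum>i\<in>V. u i * (\<Sum>j\<in>V. A i j * p j))"
  unfolding bil_def by (simp add: sum_distrib_left mult_ac)

lemma bil_unit_left:
  assumes "finite V" "i \<in> V"
  shows "bil V A (\<lambda>j. if j = i then 1 else 0) p = (\<Sum>j\<in>V. A i j * p j)"
  using assms by (simp add: bil_row if_distrib[where f = "\<lambda>x. x * _"] cong: if_cong)

lemma bil_supported:
  assumes "finite V" "V' \<subseteq> V" "\<And>i j. i \<in> V \<Longrightarrow> j \<in> V \<Longrightarrow> i \<notin> V' \<or> j \<notin> V' \<Longrightarrow> A i j * u i * p j = 0"
  shows "bil V A u p = bil V' A u p"
proof -
  have "bil V A u p = (\<Sum>i\<in>V. \<Sum>j\<in>V'. A i j * u i * p j)"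
    unfolding bil_def using assms by (intro sum.cong refl sum.mono_neutral_right) auto
  also have "\<dots> = bil V' A u p"
    unfolding bil_def using assms by (intro sum.mono_neutral_right ballI sum.neutral) auto
  finally show ?thesis .
qed

section \<open>Stability of the Lorentzian condition\<close>

lemma lorentzian_cong:
  assumes "\<And>i j. i \<in> V \<Longrightarrow> j \<in> V \<Longrightarrow> A i j = B i j"
  shows "lorentzian V A \<longleftrightarrow> lorentzian V B"
proof -
  have "bil V A u p = bil V B u p" for u p
    using assms by (rule bil_cong) auto
  then show ?thesis
    unfolding lorentzian_def by simp
qed

lemma lorentzian_subset:
  assumes "lorentzian V A" "finite V" "V' \<subseteq> V"
  shows "lorentzian V' A"
proof -
  have *: "bil V' A u p = bil V A (\<lambda>i. if i \<in> V' then u i else 0) (\<lambda>i. if i \<in> V' then p i else 0)" for u p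
    using assms(2,3) by (subst bil_supported[of V V']) (auto intro: bil_cong)
  show ?thesis
    using assms(1) unfolding lorentzian_def * by blast
qed

lemma lorentzian_superset:
  assumes "lorentzian V' A" "finite V" "V' \<subseteq> V"
    and "\<And>i j. i \<in> V \<Longrightarrow> j \<in> V \<Longrightarrow> i \<notin> V' \<or> j \<notin> V' \<Longrightarrow> A i j = 0"
  shows "lorentzian V A"
proof -
  have "bil V A u p = bil V' A u p" for u p
    using assms by (intro bil_supported) auto
  then show ?thesis
    using assms(1) unfolding lorentzian_def by simp
qed

lemma lorentzian_scale:
  assumes "lorentzian V A" "c \<ge> 0"
  shows "lorentzian V (\<lambda>i j. c * A i j)"
proof -
  have *: "bil V (\<lambda>i j. c * A i j) u p = c * bil V A u p" for u p
    by (simp add: bil_def sum_distrib_left mult_ac)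
  show ?thesis
    unfolding lorentzian_def *
  proof (intro allI impI)
    fix u p assume "0 < c * bil V A p p"
    then have "0 < bil V A p p"
      using assms(2) by (simp add: zero_less_mult_iff)
    then have "c\<^sup>2 * (bil V A u u * bil V A p p) \<le> c\<^sup>2 * (bil V A u p)\<^sup>2"
      using assms(1) unfolding lorentzian_def by (intro mult_left_mono) auto
    then show "c * bil V A u u * (c * bil V A p p) \<le> (c * bil V A u p)\<^sup>2"
      by (simp add: power2_eq_square mult_ac)
  qed
qed

text \<open>Any two vectors have a combination orthogonal to \<open>v\<close>, where the form is
  nonpositive; completing the square in that bound gives the inequality.\<close>

lemma lorentzianI:
  assumes sym: "\<And>i j. i \<in> V \<Longrightarrow> j \<in> V \<Longrightarrow> A i j = A j i"
    and neg: "\<And>h. bil V A h v = 0 \<Longrightarrow> bil V A h h \<le> 0"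
  shows "lorentzian V A"
  unfolding lorentzian_def
proof (intro allI impI)
  fix u p assume pp: "0 < bil V A p p"
  define a b where "a = bil V A p v" and "b = bil V A u v"
  \<comment> \<open>Otherwise \<open>p\<close> itself would be orthogonal to \<open>v\<close>, and
    \<open>neg\<close> would contradict \<open>pp\<close>.\<close>
  have a: "a \<noteq> 0"
    using neg[of p] pp unfolding a_def by auto
  have pu: "bil V A p u = bil V A u p"
    by (rule bil_sym[OF sym])
  define t where "t = (\<lambda>i. a * u i + (- b) * p i)"
  have "bil V A t v = 0"
    unfolding t_def bil_linear a_def[symmetric] b_def[symmetric] by simp
  from neg[OF this] have "a\<^sup>2 * bil V A u u - 2 * a * b * bil V A u p + b\<^sup>2 * bil V A p p \<le> 0"
    unfolding t_def bil_linear pu by (simp add: power2_eq_square algebra_simps)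
  then have "bil V A p p * (a\<^sup>2 * bil V A u u - 2 * a * b * bil V A u p + b\<^sup>2 * bil V A p p) \<le> 0"
    using pp by (simp add: mult_le_0_iff)
  moreover have "bil V A p p * (a\<^sup>2 * bil V A u u - 2 * a * b * bil V A u p + b\<^sup>2 * bil V A p p)
     = (b * bil V A p p - a * bil V A u p)\<^sup>2 + a\<^sup>2 * (bil V A u u * bil V A p p - (bil V A u p)\<^sup>2)"
    by (simp add: power2_eq_square algebra_simps)
  ultimately have "a\<^sup>2 * (bil V A u u * bil V A p p - (bil V A u p)\<^sup>2) \<le> 0"
    using zero_le_power2[of "b * bil V A p p - a * bil V A u p"] by linarith
  then show "bil V A u u * bil V A p p \<le> (bil V A u p)\<^sup>2"
    using a by (simp add: mult_le_0_iff)
qed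

text \<open>The premise of the inequality is an open condition and its conclusion a closed one:
  positivity at \<open>p\<close> in the limit holds for almost all \<open>m\<close>, and then the
  inequality passes to the limit.\<close>

lemma lorentzian_limit:
  assumes "\<And>m. lorentzian V (A m)"
    and lim: "\<And>i j. i \<in> V \<Longrightarrow> j \<in> V \<Longrightarrow> (\<lambda>m. A m i j) \<longlonglongrightarrow> B i j"
  shows "lorentzian V B"
  unfolding lorentzian_def
proof (intro allI impI)
  fix u p assume pp: "0 < bil V B p p"
  have l: "(\<lambda>m. bil V (A m) u p) \<longlonglongrightarrow> bil V B u p" for u p
    unfolding bil_def by (intro tendsto_intros lim)
  have "\<forall>\<^sub>F m in sequentially. 0 < bil V (A m) p p"
    using order_tendstoD(1)[OF l pp] .
  then have "\<forall>\<^sub>F m in sequentially. bil V (A m) u u * bil V (A m) p p \<le> (bil V (A m) u p)\<^sup>2"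
    by eventually_elim (use assms(1) in \<open>auto simp: lorentzian_def\<close>)
  then show "bil V B u u * bil V B p p \<le> (bil V B u p)\<^sup>2"
    by (rule tendsto_le[OF sequentially_bot tendsto_power[OF l] tendsto_mult[OF l l]])
qed

text \<open>First-order condition for a minimum at \<open>t = 0\<close>; it turns maximality of a
  Rayleigh quotient into a linear equation.\<close>

lemma quadratic_nonneg_linear_zero:
  fixes b c :: real
  assumes "\<And>t. 0 \<le> 2 * t * b + t\<^sup>2 * c"
  shows "b = 0"
proof (rule ccontr)
  assume b: "b \<noteq> 0"
  \<comment> \<open>Small enough that at \<open>t = - s * b\<close> the linear term outweighs the
    quadratic one.\<close>
  define s where "s = 1 / (\<bar>c\<bar> + 1)"
  have s: "s > 0" "s * \<bar>c\<bar> \<le> 1"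
    by (auto simp: s_def field_simps)
  have "0 \<le> 2 * (- s * b) * b + (- s * b)\<^sup>2 * c" by (rule assms)
  also have "\<dots> = s * b\<^sup>2 * (s * c - 2)"
    by (simp add: power2_eq_square algebra_simps)
  finally have "0 \<le> s * b\<^sup>2 * (s * c - 2)" .
  moreover have "s * c - 2 < 0"
    using s mult_left_mono[of c "\<bar>c\<bar>" s] by linarith
  moreover have "s * b\<^sup>2 > 0" using s b by simp
  ultimately show False
    by (simp add: zero_le_mult_iff)
qed

text \<open>A maximiser of the Rayleigh quotient on the \<open>W\<close>-orthogonal complement of \<open>v\<close> is a
  generalised eigenvector.\<close>

lemma second_eigenvector:
  assumes fin: "finite V"
    and sym: "\<And>i j. i \<in> V \<Longrightarrow> j \<in> V \<Longrightarrow> A i j = A j i"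
    and W: "\<And>i. i \<in> V \<Longrightarrow> 0 < W i" and v: "\<And>i. i \<in> V \<Longrightarrow> 0 < v i"
    and Av: "\<And>i. i \<in> V \<Longrightarrow> (\<Sum>j\<in>V. A i j * v j) = W i * v i"
    and h: "(\<Sum>i\<in>V. W i * v i * h i) = 0" "0 < bil V A h h"
  obtains x l where "0 < l" "(\<Sum>i\<in>V. W i * (x i)\<^sup>2) = 1" "(\<Sum>i\<in>V. W i * v i * x i) = 0"
    "\<And>i. i \<in> V \<Longrightarrow> (\<Sum>j\<in>V. A i j * x j) = l * (W i * x i)"
proof -
  define N where "N x = (\<Sum>i\<in>V. W i * (x i)\<^sup>2)" for x :: "'a \<Rightarrow> real"
  define P where "P x = (\<Sum>i\<in>V. W i * v i * x i)" for x :: "'a \<Rightarrow> real"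
  \<comment> \<open>Unit vectors for the \<open>W\<close>-norm, orthogonal to \<open>v\<close>.
    Fixing the coordinates outside \<open>V\<close> makes this set compact in the product topology
    on all functions.\<close>
  define K where "K = {x. (\<forall>i. i \<notin> V \<longrightarrow> x i = 0) \<and> N x = 1 \<and> P x = 0}"
  have N_nonneg: "0 \<le> N x" for x
    unfolding N_def using W by (intro sum_nonneg) (simp add: less_imp_le)
  have N_zero: "x i = 0" if "N x = 0" "i \<in> V" for x i
  proof -
    have "\<forall>i\<in>V. W i * (x i)\<^sup>2 = 0"
      using that(1) unfolding N_def
      by (subst (asm) sum_nonneg_eq_0_iff[OF fin]) (use W in \<open>auto simp: less_imp_le\<close>)
    then show ?thesis using W[OF that(2)] that(2) by auto
  qed
  have le_box: "x \<in> PiE UNIV (\<lambda>i. if i \<in> V then {- (1 + 1 / W i)..1 + 1 / W i} else {0})" if "x \<in> K" for x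
  proof -
    have "\<bar>x i\<bar> \<le> 1 + 1 / W i" if i: "i \<in> V" for i
    proof -
      have "W i * (x i)\<^sup>2 \<le> N x"
        unfolding N_def using i W by (intro member_le_sum fin) (auto simp: less_imp_le)
      also have "N x = 1" using \<open>x \<in> K\<close> by (simp add: K_def)
      finally have "(x i)\<^sup>2 \<le> 1 / W i"
        using W[OF i] by (simp add: field_simps)
      also have "\<dots> \<le> (1 + 1 / W i)\<^sup>2"
        using W[OF i] by (simp add: power2_eq_square field_simps)
      finally show ?thesis
        using W[OF i] by (intro power2_le_imp_le[of "\<bar>x i\<bar>"]) auto
    qed
    moreover have "x i = 0" if "i \<notin> V" for i
      using \<open>x \<in> K\<close> that by (simp add: K_def)
    ultimately show ?thesis
      unfolding PiE_UNIV_domain by (fastforce simp: abs_le_iff)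
  qed
  have "compactin (product_topology (\<lambda>i. euclidean) UNIV)
      (PiE UNIV (\<lambda>i. if i \<in> V then {- (1 + 1 / W i)..1 + 1 / W i} else {0}))"
    by (subst compactin_PiE) auto
  then have box: "compact (PiE UNIV (\<lambda>i. if i \<in> V then {- (1 + 1 / W i)..1 + 1 / W i} else {0}))"
    by (simp add: euclidean_product_topology)
  have coord [continuous_intros]: "continuous_on S (\<lambda>x::'a \<Rightarrow> real. x i)" for S i
    by (rule continuous_on_product_then_coordinatewise) (rule continuous_on_id)
  have "K = (\<Inter>i\<in>-V. {x. x i = 0}) \<inter> {x. N x = 1} \<inter> {x. P x = 0}"
    by (auto simp: K_def)
  moreover have "closed (\<Inter>i\<in>-V. {x::'a \<Rightarrow> real. x i = 0})"
    by (intro closed_INT ballI closed_Collect_eq continuous_intros)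
  moreover have "closed {x. N x = 1}" "closed {x. P x = 0}"
    unfolding N_def P_def by (intro closed_Collect_eq continuous_intros)+
  ultimately have "closed K"
    by (simp only: closed_Int)
  moreover have "K \<subseteq> PiE UNIV (\<lambda>i. if i \<in> V then {- (1 + 1 / W i)..1 + 1 / W i} else {0})"
    using le_box by (rule subsetI)
  ultimately have "compact K"
    using compact_Int_closed[OF box, of K] by (simp only: Int_absorb1)
  \<comment> \<open>By homogeneity, the values on \<open>K\<close> control the quotient on the whole
    complement of \<open>v\<close>.\<close>
  have normal: "\<exists>y\<in>K. bil V A x x = N x * bil V A y y" if "P x = 0" "N x \<noteq> 0" for x
  proof
    define s where "s = 1 / sqrt (N x)"
    have s2: "s\<^sup>2 = 1 / N x"
      using N_nonneg[of x] by (simp add: s_def power_divide)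
    let ?y = "\<lambda>i. if i \<in> V then s * x i else 0"
    have "N ?y = s\<^sup>2 * N x" "P ?y = s * P x"
      unfolding N_def P_def sum_distrib_left by (auto intro!: sum.cong simp: power_mult_distrib)
    then show "?y \<in> K"
      using that s2 by (simp add: K_def)
    have "bil V A ?y ?y = bil V A (\<lambda>i. s * x i) (\<lambda>i. s * x i)"
      by (rule bil_cong) auto
    also have "\<dots> = s\<^sup>2 * bil V A x x"
      unfolding bil_linear by (simp add: power2_eq_square)
    finally show "bil V A x x = N x * bil V A ?y ?y"
      using that s2 by simp
  qed
  have "N h \<noteq> 0"
  proof
    assume "N h = 0"
    then have "bil V A h h = 0"
      unfolding bil_def using N_zero by (intro sum.neutral ballI) simp
    then show False using h by simp
  qed
  then obtain y where y: "y \<in> K" "bil V A h h = N h * bil V A y y"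
    using normal h(1) unfolding P_def by metis
  then have ypos: "0 < bil V A y y"
    using h(2) N_nonneg[of h] by (simp add: zero_less_mult_iff)
  have "continuous_on K (\<lambda>x. bil V A x x)"
    unfolding bil_def by (intro continuous_intros)
  then obtain x where x: "x \<in> K" "\<And>z. z \<in> K \<Longrightarrow> bil V A z z \<le> bil V A x x"
    using continuous_attains_sup[OF \<open>compact K\<close>, of "\<lambda>x. bil V A x x"] y(1) by blast
  define l where "l = bil V A x x"
  have l: "0 < l" using ypos x(2)[OF y(1)] by (simp add: l_def)
  have Nx: "N x = 1" and Px: "P x = 0"
    using x(1) by (auto simp: K_def)
  have le: "bil V A z z \<le> l * N z" if Pz: "P z = 0" for z
  proof (cases "N z = 0")
    case True
    then have "bil V A z z = 0"
      unfolding bil_def using N_zero by (intro sum.neutral ballI) simp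
    then show ?thesis using True by simp
  next
    case False
    then obtain w where "w \<in> K" "bil V A z z = N z * bil V A w w"
      using normal Pz by blast
    then show ?thesis
      using x(2)[of w] N_nonneg[of z] by (simp add: l_def mult.commute mult_left_mono)
  qed
  \<comment> \<open>First variation: \<open>x + t * z\<close> stays in the complement of
    \<open>v\<close>, so \<open>le\<close> makes a quadratic in \<open>t\<close>
    nonnegative.\<close>
  have orth: "bil V A z x = l * (\<Sum>i\<in>V. W i * z i * x i)" if "P z = 0" for z
  proof -
    have xz: "bil V A x z = bil V A z x"
      by (rule bil_sym[OF sym])
    define b where "b = l * (\<Sum>i\<in>V. W i * z i * x i) - bil V A z x"
    have "0 \<le> 2 * t * b + t\<^sup>2 * (l * N z - bil V A z z)" for t
    proof -
      let ?w = "\<lambda>i. x i + t * z i"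
      have "P ?w = P x + t * P z"
        unfolding P_def sum_distrib_left sum.distrib[symmetric] by (intro sum.cong refl) (simp add: algebra_simps)
      then have "bil V A ?w ?w \<le> l * N ?w"
        using that Px by (intro le) simp
      moreover have "bil V A ?w ?w = l + 2 * t * bil V A z x + t\<^sup>2 * bil V A z z"
        unfolding bil_linear xz
        by (simp add: l_def power2_eq_square algebra_simps)
      moreover have "N ?w = N x + 2 * t * (\<Sum>i\<in>V. W i * z i * x i) + t\<^sup>2 * N z"
        unfolding N_def sum_distrib_left sum.distrib[symmetric]
        by (intro sum.cong refl) (simp add: power2_eq_square algebra_simps)
      ultimately show ?thesis
        unfolding Nx b_def by (simp add: algebra_simps)
    qed
    then have "b = 0" by (rule quadratic_nonneg_linear_zero)
    then show ?thesis by (simp add: b_def)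
  qed
  \<comment> \<open>By \<open>Av\<close>, orthogonality to \<open>v\<close> with respect to
    \<open>W\<close> is also orthogonality with respect to \<open>A\<close>.\<close>
  have vx: "bil V A v x = 0"
  proof -
    have "bil V A v x = bil V A x v"
      by (rule bil_sym[OF sym])
    also have "\<dots> = P x"
      unfolding bil_row P_def by (intro sum.cong refl) (simp add: Av)
    finally show ?thesis using Px by simp
  qed
  show thesis
  proof (rule that[of l x])
    show "0 < l" "(\<Sum>i\<in>V. W i * (x i)\<^sup>2) = 1" "(\<Sum>i\<in>V. W i * v i * x i) = 0"
      using l Nx Px by (simp_all add: N_def P_def)
    fix i assume i: "i \<in> V"
    have Pv: "P v > 0"
      unfolding P_def using W v i fin by (intro sum_pos) auto
    \<comment> \<open>Subtracting \<open>c\<close> times \<open>v\<close> removes from the unit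
      vector at \<open>i\<close> its \<open>W\<close>-projection on \<open>v\<close>, so that
      \<open>orth\<close> applies.\<close>
    define c where "c = W i * v i / P v"
    let ?e = "\<lambda>j. if j = i then 1 else 0 :: real"
    let ?z = "\<lambda>j. ?e j + (- c) * v j"
    have e: "(\<Sum>j\<in>V. f j * ?e j) = f i" for f
      using fin i by (simp add: if_distrib cong: if_cong)
    have "P ?z = P ?e + (- c) * P v"
      unfolding P_def sum_distrib_left sum.distrib[symmetric] by (intro sum.cong refl) (simp add: algebra_simps)
    also have "\<dots> = 0"
      using Pv e[of "\<lambda>j. W j * v j"] by (simp add: c_def P_def)
    finally have "bil V A ?z x = l * (\<Sum>i\<in>V. W i * ?z i * x i)"
      by (rule orth)
    moreover have "bil V A ?z x = (\<Sum>j\<in>V. A i j * x j)"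
      unfolding bil_linear vx bil_unit_left[OF fin i] by simp
    moreover have "(\<Sum>i\<in>V. W i * ?z i * x i) = (\<Sum>j\<in>V. (W j * x j) * ?e j) + (- c) * P x"
      unfolding P_def sum_distrib_left sum.distrib[symmetric] by (intro sum.cong refl) (simp add: algebra_simps)
    ultimately show "(\<Sum>j\<in>V. A i j * x j) = l * (W i * x i)"
      unfolding e Px by simp
  qed
qed

section \<open>Products of linear forms, and an estimate for class sums\<close>

lemma lorentzian_image:
  assumes "inj_on f V" "lorentzian V (\<lambda>i j. A (f i) (f j))"
  shows "lorentzian (f ` V) A"
proof -
  have "bil (f ` V) A u p = bil V (\<lambda>i j. A (f i) (f j)) (\<lambda>i. u (f i)) (\<lambda>i. p (f i))" for u p
    using assms(1) by (simp add: bil_def sum.reindex)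
  then show ?thesis
    using assms(2) unfolding lorentzian_def by simp
qed

text \<open>The form is twice a product of two linear forms, so the defect in the inequality is a
  perfect square. This covers Hessians of a product in which each factor is differentiated
  once.\<close>

lemma lorentzian_linear_product:
  assumes fin: "finite P" "finite Q" and disj: "P \<inter> Q = {}"
    and PP: "\<And>i j. i \<in> P \<Longrightarrow> j \<in> P \<Longrightarrow> A i j = 0"
    and QQ: "\<And>i j. i \<in> Q \<Longrightarrow> j \<in> Q \<Longrightarrow> A i j = 0"
    and PQ: "\<And>i j. i \<in> P \<Longrightarrow> j \<in> Q \<Longrightarrow> A i j = f i * g j"
    and QP: "\<And>i j. i \<in> P \<Longrightarrow> j \<in> Q \<Longrightarrow> A j i = f i * g j"
  shows "lorentzian (P \<union> Q) A"
  unfolding lorentzian_def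
proof (intro allI impI)
  fix u p
  have eq: "bil (P \<union> Q) A u p = (\<Sum>i\<in>P. f i * u i) * (\<Sum>j\<in>Q. g j * p j)
      + (\<Sum>j\<in>Q. g j * u j) * (\<Sum>i\<in>P. f i * p i)" for u p
  proof -
    have "bil (P \<union> Q) A u p = (\<Sum>i\<in>P. \<Sum>j\<in>Q. A i j * u i * p j) + (\<Sum>i\<in>Q. \<Sum>j\<in>P. A i j * u i * p j)"
      using fin disj PP QQ by (simp add: bil_def sum.union_disjoint)
    also have "\<dots> = (\<Sum>i\<in>P. \<Sum>j\<in>Q. (f i * u i) * (g j * p j)) + (\<Sum>j\<in>Q. \<Sum>i\<in>P. (g j * u j) * (f i * p i))"
      using PQ QP by (intro arg_cong2[of _ _ _ _ "(+)"] sum.cong refl) simp_all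
    finally show ?thesis
      by (simp add: sum_product)
  qed
  show "bil (P \<union> Q) A u u * bil (P \<union> Q) A p p \<le> (bil (P \<union> Q) A u p)\<^sup>2"
    unfolding eq
    using zero_le_power2[of "(\<Sum>i\<in>P. f i * u i) * (\<Sum>j\<in>Q. g j * p j) - (\<Sum>j\<in>Q. g j * u j) * (\<Sum>i\<in>P. f i * p i)"]
    by (simp add: power2_eq_square algebra_simps)
qed

text \<open>The double sum is the sum of the squared class sums, and there are at most
  \<open>card G\<close> classes; the bound is Cauchy-Schwarz over the classes of
  \<open>c\<close>.\<close>

lemma square_sum_le_classes:
  fixes w :: "'b \<Rightarrow> real"
  assumes fin: "finite G"
  shows "(\<Sum>e\<in>G. w e)\<^sup>2 \<le> card G * (\<Sum>e\<in>G. \<Sum>f\<in>G. if c e = c f then w e * w f else 0)"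
proof -
  define s where "s C = (\<Sum>e\<in>{x \<in> G. c x = C}. w e)" for C
  have "(\<Sum>e\<in>G. \<Sum>f\<in>G. if c e = c f then w e * w f else 0) = (\<Sum>e\<in>G. w e * s (c e))"
    unfolding s_def sum.inter_filter[OF fin] sum_distrib_left by (intro sum.cong refl) auto
  also have "\<dots> = (\<Sum>C\<in>c ` G. \<Sum>e\<in>{x \<in> G. c x = C}. w e * s (c e))"
    by (rule sum.image_gen[OF fin])
  also have "\<dots> = (\<Sum>C\<in>c ` G. (s C)\<^sup>2)"
    by (intro sum.cong refl) (simp add: s_def power2_eq_square sum_distrib_right)
  finally have eq: "(\<Sum>e\<in>G. \<Sum>f\<in>G. if c e = c f then w e * w f else 0) = (\<Sum>C\<in>c ` G. (s C)\<^sup>2)" .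
  have "(\<Sum>e\<in>G. w e) = (\<Sum>C\<in>c ` G. s C)"
    unfolding s_def by (rule sum.image_gen[OF fin])
  then have "(\<Sum>e\<in>G. w e)\<^sup>2 \<le> (\<Sum>C\<in>c ` G. (s C)\<^sup>2) * card (c ` G)"
    using sum_squared_le_sum_of_squares[of s "c ` G"] by simp
  also have "\<dots> \<le> (\<Sum>C\<in>c ` G. (s C)\<^sup>2) * card G"
    using card_image_le[OF fin, of c] by (intro mult_left_mono sum_nonneg) auto
  finally show ?thesis
    unfolding eq by (simp add: mult.commute)
qed

section \<open>Hessians of cubic forms\<close>

text \<open>Write \<open>A\<close> for the Hessian at \<open>v\<close>, \<open>W\<close> for the diagonal matrix with \<open>A v = W v\<close>, and let
  \<open>x\<close> be an eigenvector \<open>A x = l W x\<close> orthogonal to \<open>v\<close>. The hypothesis on the slices bounds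
  \<open>l = \<langle>x, A x\<rangle>\<close> by \<open>l\<^sup>2\<close>, so \<open>l \<le> 0\<close> or \<open>l \<ge> 1\<close>; the latter is excluded because \<open>W - A\<close>
  is a Laplacian of a connected graph.\<close>

lemma lorentzian_cubic_aux:
  fixes g :: "'v \<Rightarrow> 'v \<Rightarrow> 'v \<Rightarrow> real"
  assumes fin: "finite V"
    and sym1: "\<And>i j l. i \<in> V \<Longrightarrow> j \<in> V \<Longrightarrow> l \<in> V \<Longrightarrow> g i j l = g j i l"
    and sym2: "\<And>i j l. i \<in> V \<Longrightarrow> j \<in> V \<Longrightarrow> l \<in> V \<Longrightarrow> g i j l = g i l j"
    and nonneg: "\<And>i j l. i \<in> V \<Longrightarrow> j \<in> V \<Longrightarrow> l \<in> V \<Longrightarrow> 0 \<le> g i j l"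
    and slices: "\<And>i. i \<in> V \<Longrightarrow> lorentzian V (g i)"
    and active: "\<And>i. i \<in> V \<Longrightarrow> \<exists>j\<in>V. \<exists>l\<in>V. 0 < g i j l"
    and conn: "\<And>r :: 'v \<Rightarrow> real. (\<And>i j l. i \<in> V \<Longrightarrow> j \<in> V \<Longrightarrow> l \<in> V \<Longrightarrow> 0 < g i j l \<Longrightarrow> r i = r j)
                \<Longrightarrow> \<exists>c. \<forall>i\<in>V. r i = c"
    and v: "\<And>i. i \<in> V \<Longrightarrow> 0 < v i"
  shows "lorentzian V (\<lambda>i j. \<Sum>l\<in>V. v l * g l i j)" (is "lorentzian V ?A")
proof (rule lorentzianI[where v = v])
  show symA: "?A i j = ?A j i" if "i \<in> V" "j \<in> V" for i j
    using that sym2 by (intro sum.cong refl) auto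
  have Apos: "0 \<le> ?A i j" if "i \<in> V" "j \<in> V" for i j
    using that nonneg v by (intro sum_nonneg mult_nonneg_nonneg) (auto simp: less_imp_le)
  define z where "z i = (\<Sum>j\<in>V. ?A i j * v j)" for i
  define W where "W i = z i / v i" for i
  \<comment> \<open>By total symmetry of \<open>g\<close>, slice \<open>i\<close> applied to
    \<open>v\<close> is row \<open>i\<close> of the Hessian; so the eigenvector equations also
    evaluate the slices against \<open>v\<close>.\<close>
  have slice_row: "(\<Sum>k\<in>V. g i j k * v k) = ?A i j" if "i \<in> V" "j \<in> V" for i j
  proof (rule sum.cong[OF refl])
    fix k assume "k \<in> V"
    then have "g i j k = g k i j"
      using sym1[of k i j] sym2[of i k j] that by simp
    then show "g i j k * v k = v k * g k i j" by simp
  qed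
  have slice_v: "bil V (g i) x v = (\<Sum>j\<in>V. ?A i j * x j)" if "i \<in> V" for i x
    unfolding bil_row by (intro sum.cong refl) (simp only: slice_row[OF that] mult.commute[of "x _"])
  have zpos: "0 < z i" if i: "i \<in> V" for i
  proof -
    obtain j l where jl: "j \<in> V" "l \<in> V" "0 < g i j l" using active[OF i] by blast
    have "g i j l = g l i j"
      using i jl sym1[of l i j] sym2[of i l j] by simp
    then have "0 < v l * g l i j" using jl v by simp
    also have "\<dots> \<le> ?A i j"
      using i jl fin nonneg v by (intro member_le_sum) (auto simp: less_imp_le)
    finally have "0 < ?A i j * v j" using jl v by simp
    also have "\<dots> \<le> z i"
      unfolding z_def using i jl fin v Apos
      by (intro member_le_sum[of j V "\<lambda>j. ?A i j * v j"]) (auto simp: less_imp_le)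
    finally show ?thesis .
  qed
  have Wpos: "0 < W i" and Wv: "W i * v i = z i" if "i \<in> V" for i
    using zpos[OF that] v[OF that] by (simp_all add: W_def)
  have rowA: "bil V ?A h v = (\<Sum>i\<in>V. W i * v i * h i)" for h
    unfolding bil_row by (intro sum.cong refl) (simp only: Wv, simp add: z_def)
  fix h assume h: "bil V ?A h v = 0"
  show "bil V ?A h h \<le> 0"
  proof (rule ccontr)
    assume "\<not> bil V ?A h h \<le> 0"
    then have hpos: "0 < bil V ?A h h" by simp
    have Av: "(\<Sum>j\<in>V. ?A i j * v j) = W i * v i" if "i \<in> V" for i
      using Wv[OF that] by (simp add: z_def)
    have hP: "(\<Sum>i\<in>V. W i * v i * h i) = 0"
      using h rowA by simp
    obtain x l where l: "0 < l" and Nx: "(\<Sum>i\<in>V. W i * (x i)\<^sup>2) = 1"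
      and Px: "(\<Sum>i\<in>V. W i * v i * x i) = 0"
      and eig: "\<And>i. i \<in> V \<Longrightarrow> (\<Sum>j\<in>V. ?A i j * x j) = l * (W i * x i)"
      by (rule second_eigenvector[of V ?A W v h]) (assumption | rule fin symA Wpos v Av hP hpos that)+
    have xx: "bil V ?A x x = l"
    proof -
      have "bil V ?A x x = l * (\<Sum>i\<in>V. W i * (x i)\<^sup>2)"
        unfolding bil_row sum_distrib_left[of l] by (intro sum.cong refl) (simp only: eig, simp add: power2_eq_square)
      then show ?thesis by (simp add: Nx)
    qed
    \<comment> \<open>The Lorentzian inequality of slice \<open>i\<close> for \<open>x\<close>
      against \<open>v\<close>: the mixed value is \<open>l * (W i * x i)\<close> and the value at
      \<open>v\<close> is \<open>z i\<close>.\<close>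
    have slice_le: "v i * bil V (g i) x x \<le> l\<^sup>2 * (W i * (x i)\<^sup>2)" if i: "i \<in> V" for i
    proof -
      have vv: "bil V (g i) v v = z i"
        using slice_v[OF i] by (simp add: z_def)
      have "bil V (g i) x x * z i \<le> (l * (W i * x i))\<^sup>2"
        using slices[OF i] zpos[OF i] unfolding lorentzian_def
        by (metis vv slice_v[OF i] eig[OF i])
      then have "bil V (g i) x x \<le> (l * (W i * x i))\<^sup>2 / z i"
        using zpos[OF i] by (simp add: pos_le_divide_eq)
      then have "v i * bil V (g i) x x \<le> v i * ((l * (W i * x i))\<^sup>2 / z i)"
        using v[OF i] by (intro mult_left_mono) auto
      also have "\<dots> = l\<^sup>2 * (W i * (x i)\<^sup>2)"
        unfolding Wv[OF i, symmetric] using Wpos[OF i] v[OF i] by (simp add: power2_eq_square)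
      finally show ?thesis .
    qed
    have "bil V ?A x x = (\<Sum>i\<in>V. v i * bil V (g i) x x)"
    proof -
      have "(\<Sum>k\<in>V. v k * bil V (g k) x x) = (\<Sum>k\<in>V. \<Sum>i\<in>V. \<Sum>j\<in>V. v k * g k i j * x i * x j)"
        by (simp add: bil_def sum_distrib_left mult_ac)
      also have "\<dots> = (\<Sum>i\<in>V. \<Sum>k\<in>V. \<Sum>j\<in>V. v k * g k i j * x i * x j)"
        by (rule sum.swap)
      also have "\<dots> = (\<Sum>i\<in>V. \<Sum>j\<in>V. \<Sum>k\<in>V. v k * g k i j * x i * x j)"
        by (intro sum.cong refl sum.swap)
      also have "\<dots> = bil V ?A x x"
        by (simp add: bil_def sum_distrib_right)
      finally show ?thesis ..
    qed
    also have "\<dots> \<le> (\<Sum>i\<in>V. l\<^sup>2 * (W i * (x i)\<^sup>2))"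
      by (intro sum_mono slice_le)
    also have "\<dots> = l\<^sup>2"
      by (simp add: sum_distrib_left[symmetric] Nx)
    finally have "l * 1 \<le> l * l"
      by (simp add: xx power2_eq_square)
    then have l1: "1 \<le> l"
      using l by (metis mult_le_cancel_left_pos)
    \<comment> \<open>With the weights \<open>T\<close> below, the Dirichlet energy of
      \<open>r\<close> equals \<open>2 - 2 * l\<close>; as \<open>1 \<le> l\<close>, it must
      vanish.\<close>
    define r where "r i = x i / v i" for i
    have rx: "x i = v i * r i" if "i \<in> V" for i
      using v[OF that] by (simp add: r_def)
    define T where "T i j = ?A i j * v i * v j" for i j
    have Tpos: "0 \<le> T i j * (r i - r j)\<^sup>2" if "i \<in> V" "j \<in> V" for i j
      using Apos[OF that] v that by (simp add: T_def less_imp_le)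
    have Tsum: "(\<Sum>j\<in>V. T i j) = W i * (v i)\<^sup>2" if "i \<in> V" for i
    proof -
      have "(\<Sum>j\<in>V. T i j) = v i * z i"
        unfolding T_def z_def sum_distrib_left by (simp add: mult_ac)
      then show ?thesis using Wv[OF that] by (simp add: power2_eq_square mult_ac)
    qed
    have N1: "(\<Sum>i\<in>V. \<Sum>j\<in>V. T i j * (r i)\<^sup>2) = 1"
    proof -
      have "(\<Sum>i\<in>V. \<Sum>j\<in>V. T i j * (r i)\<^sup>2) = (\<Sum>i\<in>V. W i * (x i)\<^sup>2)"
        by (intro sum.cong refl) (simp add: sum_distrib_right[symmetric] Tsum rx power_mult_distrib)
      then show ?thesis by (simp only: Nx)
    qed
    have N2: "(\<Sum>i\<in>V. \<Sum>j\<in>V. T i j * (r j)\<^sup>2) = 1"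
    proof -
      have "(\<Sum>i\<in>V. \<Sum>j\<in>V. T i j * (r j)\<^sup>2) = (\<Sum>j\<in>V. \<Sum>i\<in>V. T i j * (r j)\<^sup>2)"
        by (rule sum.swap)
      also have "\<dots> = (\<Sum>i\<in>V. \<Sum>j\<in>V. T i j * (r i)\<^sup>2)"
        using symA by (intro sum.cong refl) (simp add: T_def)
      finally show ?thesis using N1 by simp
    qed
    have N3: "(\<Sum>i\<in>V. \<Sum>j\<in>V. T i j * (r i * r j)) = l"
    proof -
      have "(\<Sum>i\<in>V. \<Sum>j\<in>V. T i j * (r i * r j)) = bil V ?A x x"
        unfolding bil_def by (intro sum.cong refl) (simp add: T_def rx mult_ac)
      then show ?thesis using xx by simp
    qed
    have "(\<Sum>i\<in>V. \<Sum>j\<in>V. T i j * (r i - r j)\<^sup>2)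
        = (\<Sum>i\<in>V. \<Sum>j\<in>V. T i j * (r i)\<^sup>2) + (\<Sum>i\<in>V. \<Sum>j\<in>V. T i j * (r j)\<^sup>2)
          - 2 * (\<Sum>i\<in>V. \<Sum>j\<in>V. T i j * (r i * r j))"
      unfolding sum_distrib_left sum.distrib[symmetric] sum_subtractf[symmetric]
      by (intro sum.cong refl) (simp add: power2_eq_square algebra_simps)
    then have "(\<Sum>i\<in>V. \<Sum>j\<in>V. T i j * (r i - r j)\<^sup>2) \<le> 0"
      unfolding N1 N2 N3 using l1 by simp
    moreover have "0 \<le> (\<Sum>i\<in>V. \<Sum>j\<in>V. T i j * (r i - r j)\<^sup>2)"
      by (intro sum_nonneg Tpos)
    ultimately have "(\<Sum>i\<in>V. \<Sum>j\<in>V. T i j * (r i - r j)\<^sup>2) = 0"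
      by linarith
    then have T0: "T i j * (r i - r j)\<^sup>2 = 0" if "i \<in> V" "j \<in> V" for i j
      using that Tpos fin by (simp add: sum_nonneg_eq_0_iff sum_nonneg)
    have "r i = r j" if "i \<in> V" "j \<in> V" "k \<in> V" "0 < g i j k" for i j k
    proof -
      have "g i j k = g k i j"
        using that sym1[of k i j] sym2[of i k j] by simp
      then have "0 < v k * g k i j" using that v by simp
      also have "\<dots> \<le> ?A i j"
        using that fin nonneg v by (intro member_le_sum) (auto simp: less_imp_le)
      finally have "0 < T i j" using that v by (simp add: T_def)
      then show ?thesis using T0[OF that(1,2)] by simp
    qed
    \<comment> \<open>Connectivity makes \<open>x\<close> a multiple of \<open>v\<close>, which is
      incompatible with \<open>Px\<close> and \<open>Nx\<close>.\<close>
    then obtain c where c: "\<And>i. i \<in> V \<Longrightarrow> r i = c"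
      using conn by blast
    have "(\<Sum>i\<in>V. W i * (x i)\<^sup>2) = c * (\<Sum>i\<in>V. W i * v i * x i)"
      unfolding sum_distrib_left by (intro sum.cong refl) (simp add: rx c power2_eq_square mult_ac)
    then show False
      unfolding Nx Px by simp
  qed
qed

text \<open>Reduction to the strictly positive case: indices occurring in no positive coefficient
  are dropped, and \<open>v\<close> is approximated by positive vectors. The hypothesis
  \<open>conn\<close> expresses connectivity of the remaining indices under joint occurrence in a
  positive coefficient.\<close>

lemma lorentzian_cubic:
  fixes g :: "'v \<Rightarrow> 'v \<Rightarrow> 'v \<Rightarrow> real"
  assumes fin: "finite V"
    and sym1: "\<And>i j l. i \<in> V \<Longrightarrow> j \<in> V \<Longrightarrow> l \<in> V \<Longrightarrow> g i j l = g j i l"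
    and sym2: "\<And>i j l. i \<in> V \<Longrightarrow> j \<in> V \<Longrightarrow> l \<in> V \<Longrightarrow> g i j l = g i l j"
    and nonneg: "\<And>i j l. i \<in> V \<Longrightarrow> j \<in> V \<Longrightarrow> l \<in> V \<Longrightarrow> 0 \<le> g i j l"
    and slices: "\<And>i. i \<in> V \<Longrightarrow> lorentzian V (g i)"
    and conn: "\<And>r :: 'v \<Rightarrow> real. (\<And>i j l. i \<in> V \<Longrightarrow> j \<in> V \<Longrightarrow> l \<in> V \<Longrightarrow> 0 < g i j l \<Longrightarrow> r i = r j)
                \<Longrightarrow> \<exists>c. \<forall>i\<in>V. (\<exists>j\<in>V. \<exists>l\<in>V. 0 < g i j l) \<longrightarrow> r i = c"
    and v: "\<And>i. i \<in> V \<Longrightarrow> 0 \<le> v i"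
  shows "lorentzian V (\<lambda>i j. \<Sum>l\<in>V. v l * g l i j)"
proof -
  define V' where "V' = {i \<in> V. \<exists>j\<in>V. \<exists>l\<in>V. 0 < g i j l}"
  have V': "V' \<subseteq> V" "finite V'" using fin by (auto simp: V'_def)
  have inV': "i \<in> V' \<and> j \<in> V' \<and> l \<in> V'"
    if "i \<in> V" "j \<in> V" "l \<in> V" "0 < g i j l" for i j l
  proof -
    have "g i j l = g j i l" "g i j l = g l i j"
      using that(1-3) sym1[of i j l] sym1[of l i j] sym2[of i l j] by simp_all
    then have "0 < g j i l" "0 < g l i j"
      using that(4) by metis+
    then show ?thesis using that unfolding V'_def by blast
  qed
  have zero: "g i j l = 0" if "i \<in> V" "j \<in> V" "l \<in> V" "i \<notin> V' \<or> j \<notin> V' \<or> l \<notin> V'" for i j l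
    using inV'[of i j l] nonneg[of i j l] that by force
  have pos: "lorentzian V (\<lambda>i j. \<Sum>l\<in>V. w l * g l i j)" if w: "\<And>i. i \<in> V \<Longrightarrow> 0 < w i" for w
  proof -
    have "lorentzian V' (\<lambda>i j. \<Sum>l\<in>V'. w l * g l i j)"
    proof (rule lorentzian_cubic_aux)
      fix i assume i: "i \<in> V'"
      then show "lorentzian V' (g i)"
        using slices fin V' by (auto intro: lorentzian_subset[of V])
      obtain j l where "j \<in> V" "l \<in> V" "0 < g i j l" using i unfolding V'_def by blast
      then show "\<exists>j\<in>V'. \<exists>l\<in>V'. 0 < g i j l"
        using inV'[of i j l] i V' by blast
    next
      fix r :: "'v \<Rightarrow> real"
      assume r: "\<And>i j l. i \<in> V' \<Longrightarrow> j \<in> V' \<Longrightarrow> l \<in> V' \<Longrightarrow> 0 < g i j l \<Longrightarrow> r i = r j"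
      have "\<exists>c. \<forall>i\<in>V. (\<exists>j\<in>V. \<exists>l\<in>V. 0 < g i j l) \<longrightarrow> r i = c"
        by (rule conn) (use r inV' in blast)
      then show "\<exists>c. \<forall>i\<in>V'. r i = c"
        unfolding V'_def by blast
    qed (use V' w sym1 sym2 nonneg in \<open>auto simp: subset_iff\<close>)
    then have "lorentzian V (\<lambda>i j. \<Sum>l\<in>V'. w l * g l i j)"
      by (rule lorentzian_superset) (use fin V' zero in \<open>auto intro!: sum.neutral simp: subset_iff\<close>)
    moreover have "(\<Sum>l\<in>V'. w l * g l i j) = (\<Sum>l\<in>V. w l * g l i j)" if "i \<in> V" "j \<in> V" for i j
      using fin V' zero that by (intro sum.mono_neutral_left) auto
    ultimately show ?thesis
      by (subst (asm) lorentzian_cong) auto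
  qed
  show ?thesis
  proof (rule lorentzian_limit)
    show "lorentzian V (\<lambda>i j. \<Sum>l\<in>V. (v l + 1 / real (Suc m)) * g l i j)" for m
      using v by (intro pos add_nonneg_pos) auto
    show "(\<lambda>m. \<Sum>l\<in>V. (v l + 1 / real (Suc m)) * g l i j) \<longlonglongrightarrow> (\<Sum>l\<in>V. v l * g l i j)" for i j
    proof (intro tendsto_intros)
      fix l
      have "(\<lambda>m. v l + 1 / real (Suc m)) \<longlonglongrightarrow> v l + 0"
        by (intro tendsto_add tendsto_const) (rule LIMSEQ_inverse_real_of_nat[unfolded inverse_eq_divide])
      then show "(\<lambda>m. v l + 1 / real (Suc m)) \<longlonglongrightarrow> v l" by simp
    qed
  qed
qed

section \<open>Generating polynomials of independent sets\<close>

definition elts :: "'a option multiset \<Rightarrow> 'a set" where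
  "elts D = {e. Some e \<in># D}"

lemma elts_add_None [simp]: "elts (add_mset None D) = elts D"
  by (auto simp: elts_def)

lemma elts_add_Some [simp]: "elts (add_mset (Some e) D) = insert e (elts D)"
  by (auto simp: elts_def)

lemma size_eq_count_None_card_elts:
  "(\<And>e. count D (Some e) \<le> 1) \<Longrightarrow> finite (elts D) \<and> size D = count D None + card (elts D)"
proof (induction D)
  case empty
  then show ?case by (simp add: elts_def)
next
  case (add p D)
  have "count D (Some e) \<le> 1" for e
    using add.prems[of e] by (auto split: if_splits)
  then have IH: "finite (elts D)" "size D = count D None + card (elts D)"
    using add.IH by auto
  show ?case
  proof (cases p)
    case None
    then show ?thesis using IH by simp
  next
    case (Some e)
    then have "count D (Some e) = 0"
      using add.prems[of e] by simp
    then have "e \<notin> elts D"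
      by (simp add: elts_def not_in_iff)
    then show ?thesis using IH Some by simp
  qed
qed

text \<open>\<open>Inl\<close> directions differentiate the first factor of the product,
  \<open>Inr\<close> directions the second.\<close>

fun push :: "'a option + 'a option \<Rightarrow> 'a option multiset \<times> 'a option multiset
    \<Rightarrow> 'a option multiset \<times> 'a option multiset" where
  "push (Inl p) (D, D') = (add_mset p D, D')"
| "push (Inr p) (D, D') = (D, add_mset p D')"

lemma push_commute: "push p (push q D) = push q (push p D)"
  by (cases D; cases p; cases q) (simp_all add: add_mset_commute)

text \<open>The homogeneous generating polynomial of the independent sets is
  \<open>F(x, w) = \<Sum>\<^sub>I x\<^bsup>n - |I|\<^esup> \<Prod>\<^bsub>e \<in> I\<^esub> w\<^sub>e\<close>. A multiset \<open>D\<close> of size \<open>n\<close> encodes a differential operator of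
  order \<open>n\<close>, where \<open>None\<close> stands for \<open>\<partial>/\<partial>x\<close> and \<open>Some e\<close> for \<open>\<partial>/\<partial>w\<^sub>e\<close>; \<open>psi n D\<close> is the constant
  that it yields on \<open>F\<close>. Likewise \<open>phi n S (D, D')\<close> is the value on
  \<open>F(x, w) F(y, u)\<close> of \<open>D\<close> in \<open>(x, w)\<close>, \<open>D'\<close> in \<open>(y, u)\<close> and \<open>\<partial>/\<partial>w\<^sub>e + \<partial>/\<partial>u\<^sub>e\<close> for \<open>e \<in> S\<close>.\<close>

context matroid
begin

definition psi :: "nat \<Rightarrow> 'a option multiset \<Rightarrow> real" where
  "psi n D = (if size D = n \<and> (\<forall>e. count D (Some e) \<le> 1) \<and> indep (elts D)
              then fact (count D None) else 0)"

fun phi :: "nat \<Rightarrow> 'a list \<Rightarrow> 'a option multiset \<times> 'a option multiset \<Rightarrow> real" where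
  "phi n [] D = psi n (fst D) * psi n (snd D)"
| "phi n (e # S) D = phi n S (push (Inl (Some e)) D) + phi n S (push (Inr (Some e)) D)"

section \<open>Supports of the generating polynomials: heredity and exchange\<close>

lemma psi_nonneg: "0 \<le> psi n D"
  by (simp add: psi_def)

lemma psi_pos_iff:
  "0 < psi n D \<longleftrightarrow> size D = n \<and> (\<forall>e. count D (Some e) \<le> 1) \<and> indep (elts D)"
  by (simp add: psi_def)

lemma phi_nonneg: "0 \<le> phi n S D"
  by (induction S arbitrary: D) (simp_all add: psi_nonneg)

text \<open>Trading a derivative in an element variable for one in \<open>x\<close> deletes that
  element from the independent set, and heredity keeps the value positive.\<close>

lemma psi_demote:
  assumes "0 < psi n (add_mset p D)"
  shows "0 < psi n (add_mset None D)"
proof (cases p)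
  case (Some e)
  have "count D (Some f) \<le> 1" for f
    using assms unfolding psi_pos_iff by (metis count_add_mset le_SucI not_less_eq_eq)
  moreover have "indep (elts D)"
    using assms Some unfolding psi_pos_iff by (auto intro: indep_subset)
  ultimately show ?thesis
    using assms by (simp add: psi_pos_iff)
qed (use assms in simp)

text \<open>At fixed order, fewer derivatives in \<open>x\<close> mean a larger set: the hypotheses
  give \<open>card (elts X) < card (elts Y)\<close>, and augmentation supplies
  \<open>e\<close>.\<close>

lemma psi_exchange:
  assumes X: "0 < psi n (add_mset None X)" and Y: "0 < psi n Y" and le: "count Y None \<le> count X None"
  obtains e where "Some e \<in># Y" "Some e \<notin># X" "0 < psi n (add_mset (Some e) X)"
proof -
  have X': "size X + 1 = n" "\<And>e. count X (Some e) \<le> 1" "indep (elts X)"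
    using X by (auto simp: psi_pos_iff)
  have Y': "size Y = n" "\<And>e. count Y (Some e) \<le> 1" "indep (elts Y)"
    using Y by (auto simp: psi_pos_iff)
  have "card (elts X) < card (elts Y)"
    using size_eq_count_None_card_elts[OF X'(2)] size_eq_count_None_card_elts[OF Y'(2)] X'(1) Y'(1) le
    by linarith
  then obtain e where e: "e \<in> elts Y - elts X" "indep (insert e (elts X))"
    using augment[OF X'(3) Y'(3)] by blast
  show thesis
  proof (rule that)
    show "Some e \<in># Y" "Some e \<notin># X" using e by (auto simp: elts_def)
    then show "0 < psi n (add_mset (Some e) X)"
      using X' e by (auto simp: psi_pos_iff not_in_iff)
  qed
qed

text \<open>All terms of the Leibniz expansion are nonnegative, so nothing cancels: one good
  distribution of \<open>S\<close> over the two factors suffices. \<open>A\<close> and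
  \<open>B\<close> are multisets because \<open>S\<close> may have repetitions.\<close>

lemma phi_pos_iff:
  "0 < phi n S (D, D') \<longleftrightarrow> (\<exists>A B. mset S = A + B \<and>
      0 < psi n (D + image_mset Some A) \<and> 0 < psi n (D' + image_mset Some B))"
proof (induction S arbitrary: D D')
  case Nil
  then show ?case
    using psi_nonneg[of n D] psi_nonneg[of n D'] by (auto simp: zero_less_mult_iff)
next
  case (Cons e S)
  have "0 < phi n (e # S) (D, D') \<longleftrightarrow>
      0 < phi n S (add_mset (Some e) D, D') \<or> 0 < phi n S (D, add_mset (Some e) D')"
    using phi_nonneg[of n S "(add_mset (Some e) D, D')"] phi_nonneg[of n S "(D, add_mset (Some e) D')"]
    by auto
  also have "\<dots> \<longleftrightarrow> (\<exists>A B. mset (e # S) = A + B \<and>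
      0 < psi n (D + image_mset Some A) \<and> 0 < psi n (D' + image_mset Some B))"
    (is "?L \<longleftrightarrow> ?R")
  proof
    assume ?L
    then show ?R
    proof
      assume "0 < phi n S (add_mset (Some e) D, D')"
      then obtain A B where "mset S = A + B" "0 < psi n (add_mset (Some e) D + image_mset Some A)"
        "0 < psi n (D' + image_mset Some B)"
        unfolding Cons.IH by blast
      then show ?R
        by (intro exI[of _ "add_mset e A"] exI[of _ B]) simp
    next
      assume "0 < phi n S (D, add_mset (Some e) D')"
      then obtain A B where "mset S = A + B" "0 < psi n (D + image_mset Some A)"
        "0 < psi n (add_mset (Some e) D' + image_mset Some B)"
        unfolding Cons.IH by blast
      then show ?R
        by (intro exI[of _ A] exI[of _ "add_mset e B"]) simp
    qed
  next
    assume ?R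
    then obtain A B where AB: "mset (e # S) = A + B" "0 < psi n (D + image_mset Some A)"
      "0 < psi n (D' + image_mset Some B)" by blast
    then have "e \<in># A + B" by (metis list.set_intros(1) set_mset_mset)
    then consider "e \<in># A" | "e \<in># B" by auto
    then show ?L
    proof cases
      case 1
      then obtain A' where A': "A = add_mset e A'" by (metis insert_DiffM)
      then have "0 < phi n S (add_mset (Some e) D, D')"
        unfolding Cons.IH using AB by (intro exI[of _ A'] exI[of _ B]) simp
      then show ?thesis ..
    next
      case 2
      then obtain B' where B': "B = add_mset e B'" by (metis insert_DiffM)
      then have "0 < phi n S (D, add_mset (Some e) D')"
        unfolding Cons.IH using AB by (intro exI[of _ A] exI[of _ B']) simp
      then show ?thesis ..
    qed
  qed
  finally show ?case .
qed

definition base :: "'a option + 'a option \<Rightarrow> 'a option + 'a option" where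
  "base p = (case p of Inl _ \<Rightarrow> Inl None | Inr _ \<Rightarrow> Inr None)"

lemma phi_demote: "0 < phi n S (push p D) \<Longrightarrow> 0 < phi n S (push (base p) D)"
proof (induction S arbitrary: D)
  case Nil
  then show ?case
    using psi_nonneg by (cases D; cases p) (auto simp: base_def zero_less_mult_iff not_less[symmetric] intro: psi_demote)
next
  case (Cons e S)
  have *: "0 < phi n (e # S) D \<longleftrightarrow> 0 < phi n S (push (Inl (Some e)) D) \<or> 0 < phi n S (push (Inr (Some e)) D)" for D
    using phi_nonneg[of n S "push (Inl (Some e)) D"] phi_nonneg[of n S "push (Inr (Some e)) D"]
    by auto
  show ?case
    using Cons.prems Cons.IH unfolding * by (metis push_commute)
qed

text \<open>Compare a distribution of \<open>S\<close> witnessing three derivatives in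
  \<open>x\<close> with one witnessing three in \<open>y\<close>: augmentation moves an element from
  the second factor to the first, while one derivative in \<open>x\<close> is traded for one in
  \<open>y\<close>.\<close>

lemma phi_exchange:
  assumes "0 < phi n S (push (Inl None) (push (Inl None) (push (Inl None) D)))"
    and "0 < phi n S (push (Inr None) (push (Inr None) (push (Inr None) D)))"
  shows "0 < phi n S (push (Inl None) (push (Inl None) (push (Inr None) D)))"
proof -
  obtain D1 D2 where D: "D = (D1, D2)" by (cases D)
  obtain A B where AB: "mset S = A + B"
    "0 < psi n (add_mset None (add_mset None (add_mset None D1)) + image_mset Some A)"
    "0 < psi n (D2 + image_mset Some B)"
    using assms(1) unfolding D push.simps phi_pos_iff by blast
  obtain A' B' where AB': "mset S = A' + B'" "0 < psi n (D1 + image_mset Some A')"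
    using assms(2) unfolding D push.simps phi_pos_iff by blast
  let ?X = "add_mset None (add_mset None D1) + image_mset Some A"
  have noNone: "count (image_mset Some C) None = 0" for C :: "'a multiset"
    by (auto simp: count_eq_zero_iff)
  obtain e where e: "Some e \<in># D1 + image_mset Some A'" "Some e \<notin># ?X" "0 < psi n (add_mset (Some e) ?X)"
    by (rule psi_exchange[of n ?X "D1 + image_mset Some A'"]) (use AB AB' noNone in auto)
  \<comment> \<open>\<open>Some e\<close> does not occur in \<open>D1\<close>, so it comes from
    \<open>A'\<close>; as an element of \<open>S\<close> outside \<open>A\<close>, it was assigned
    to the second factor.\<close>
  then have "e \<in># A'" "e \<notin># A" by auto
  then have "e \<in># B"
    using AB(1) AB'(1) by (metis union_iff)
  then obtain B0 where B0: "B = add_mset e B0" by (metis insert_DiffM)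
  have "0 < psi n (add_mset None D2 + image_mset Some B0)"
    using AB(3) psi_demote[of n "Some e" "D2 + image_mset Some B0"] unfolding B0 by simp
  then show ?thesis
    unfolding D push.simps phi_pos_iff using e(3) AB(1) B0
    by (intro exI[of _ "add_mset e A"] exI[of _ B0]) simp
qed

section \<open>Lorentzian Hessians of the generating polynomials\<close>

definition dirs1 :: "'a option set" where
  "dirs1 = insert None (Some ` ground)"

definition dirs :: "('a option + 'a option) set" where
  "dirs = Inl ` dirs1 \<union> Inr ` dirs1"

lemma finite_dirs1: "finite dirs1"
  by (simp add: dirs1_def ground_finite)

lemma finite_dirs: "finite dirs"
  by (simp add: dirs_def finite_dirs1)

text \<open>Unless it vanishes, the Hessian belongs to the contraction by \<open>elts D\<close>: it
  pairs \<open>x\<close> with itself, \<open>x\<close> with nonloops, and nonparallel nonloops with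
  each other. Parallelism is an equivalence relation, so the last part is a square minus the squared
  class sums, and Cauchy-Schwarz applies.\<close>

lemma psi_lorentzian:
  assumes n: "card ground \<le> n"
  shows "lorentzian dirs1 (\<lambda>p q. psi n (add_mset p (add_mset q D)))"
proof (cases "size D + 2 = n \<and> (\<forall>e. count D (Some e) \<le> 1) \<and> indep (elts D)")
  case False
  \<comment> \<open>Demoting both directions of a nonzero entry would establish the condition on
    \<open>D\<close> excluded in this case.\<close>
  have "psi n (add_mset p (add_mset q D)) = 0" for p q
  proof -
    have "\<not> 0 < psi n (add_mset p (add_mset q D))"
    proof
      assume "0 < psi n (add_mset p (add_mset q D))"
      then have "0 < psi n (add_mset None (add_mset q D))" by (rule psi_demote)
      then have "0 < psi n (add_mset q (add_mset None D))" by (simp only: add_mset_commute)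
      then have "0 < psi n (add_mset None (add_mset None D))" by (rule psi_demote)
      then show False using False by (auto simp: psi_pos_iff)
    qed
    then show ?thesis using psi_nonneg by (simp add: order.antisym not_less)
  qed
  then show ?thesis by (simp add: lorentzian_def bil_def)
next
  case True
  define I where "I = elts D"
  define a where "a = count D None"
  have cnt: "\<And>e. count D (Some e) \<le> 1" and sz: "size D + 2 = n" and indI: "indep I"
    using True by (auto simp: I_def)
  have cnt0: "count D (Some e) = 0 \<longleftrightarrow> e \<notin> I" for e
    by (simp add: I_def elts_def not_in_iff)
  have mem: "Some e \<in># D \<longleftrightarrow> e \<in> elts D" for e
    by (simp add: elts_def)
  have finI: "finite I" and cardI: "card I + a + 2 = n"
    using size_eq_count_None_card_elts[OF cnt] sz by (simp_all add: I_def a_def)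
  \<comment> \<open>The nonloops of the contraction by \<open>I\<close>; \<open>par\<close> is
    parallelism there.\<close>
  define G where "G = {e \<in> ground. e \<notin> I \<and> indep (insert e I)}"
  define par where "par e f \<longleftrightarrow> e = f \<or> \<not> indep (insert e (insert f I))" for e f
  have finG: "finite G" using ground_finite by (simp add: G_def)
  \<comment> \<open>The bound on \<open>n\<close> enters here: the power of \<open>x\<close> is high
    enough to compensate for the number of parallel classes.\<close>
  have cardG: "card G \<le> a + 2"
  proof -
    have "card (ground - I) = card ground - card I"
      using finI indep_subset_ground[OF indI] by (rule card_Diff_subset)
    moreover have "card G \<le> card (ground - I)"
      using ground_finite by (intro card_mono) (auto simp: G_def)
    ultimately show ?thesis using n cardI by linarith
  qed
  have par_sym: "par e f \<longleftrightarrow> par f e" for e f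
    by (auto simp: par_def insert_commute)
  \<comment> \<open>If \<open>e\<close> and \<open>g\<close> were independent over \<open>I\<close>,
    augmentation would extend \<open>insert f I\<close> by one of them.\<close>
  have par_trans: "par e g" if efg: "par e f" "par f g" "e \<in> G" "f \<in> G" "g \<in> G" for e f g
  proof (rule ccontr)
    assume np: "\<not> par e g"
    then have eg: "e \<noteq> g" "indep (insert e (insert g I))" by (auto simp: par_def)
    have "card (insert f I) < card (insert e (insert g I))"
      using efg eg finI by (simp add: G_def)
    then obtain y where "y \<in> insert e (insert g I) - insert f I" "indep (insert y (insert f I))"
      using augment[of "insert f I"] eg efg by (auto simp: G_def)
    then show False
      using efg np by (auto simp: par_def insert_commute)
  qed
  define c where "c e = {f \<in> G. par e f}" for e
  have c_iff: "c e = c f \<longleftrightarrow> par e f" if "e \<in> G" "f \<in> G" for e f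
  proof
    assume "c e = c f"
    moreover have "f \<in> c f" using that by (simp add: c_def par_def)
    ultimately show "par e f" by (auto simp: c_def)
  next
    assume "par e f"
    then show "c e = c f"
      using that par_trans par_sym unfolding c_def by blast
  qed
  let ?A = "\<lambda>p q. psi n (add_mset p (add_mset q D))"
  let ?V = "insert None (Some ` G)"
  have NN: "?A None None = fact (a + 2)"
    using True by (simp add: psi_def a_def)
  have NS: "?A None (Some e) = (if e \<in> G then fact (a + 1) else 0)"
    and SN: "?A (Some e) None = (if e \<in> G then fact (a + 1) else 0)" if "e \<in> ground" for e
    using that sz cnt cnt0[of e] by (auto simp: psi_def a_def I_def G_def mem)
  have SS: "?A (Some e) (Some f) = (if e \<in> G \<and> f \<in> G \<and> \<not> par e f then fact a else 0)"
    if "e \<in> ground" "f \<in> ground" for e f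
  proof -
    have "0 < ?A (Some e) (Some f) \<longleftrightarrow> e \<notin> I \<and> f \<notin> I \<and> e \<noteq> f \<and> indep (insert e (insert f I))"
      using sz cnt cnt0[of e] cnt0[of f] by (auto simp: psi_pos_iff I_def mem)
    also have "\<dots> \<longleftrightarrow> e \<in> G \<and> f \<in> G \<and> \<not> par e f"
      using that by (auto simp: G_def par_def intro: indep_subset)
    finally have pos: "0 < ?A (Some e) (Some f) \<longleftrightarrow> e \<in> G \<and> f \<in> G \<and> \<not> par e f" .
    have "?A (Some e) (Some f) = (if 0 < ?A (Some e) (Some f) then fact a else 0)"
      unfolding psi_pos_iff unfolding psi_def a_def by simp
    then show ?thesis
      unfolding pos .
  qed
  have "lorentzian ?V ?A"
  proof (rule lorentzianI[where v = "\<lambda>p. if p = None then 1 else 0"])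
    show "?A p q = ?A q p" for p q by (simp only: add_mset_commute)
    fix h :: "'a option \<Rightarrow> real"
    define s where "s = (\<Sum>e\<in>G. h (Some e))"
    define q where "q = (\<Sum>e\<in>G. \<Sum>f\<in>G. if c e = c f then h (Some e) * h (Some f) else 0)"
    define x where "x = h None"
    have split: "(\<Sum>p\<in>?V. F p) = F None + (\<Sum>e\<in>G. F (Some e))" for F :: "'a option \<Rightarrow> real"
      using finG by (simp add: sum.reindex)
    have G: "e \<in> ground" if "e \<in> G" for e using that by (simp add: G_def)
    have hv: "bil ?V ?A h (\<lambda>p. if p = None then 1 else 0) = fact (a + 1) * ((a + 2) * x + s)"
      unfolding bil_def split NN
      by (simp add: SN G x_def s_def sum_distrib_left sum.distrib algebra_simps)
    have ss: "(\<Sum>e\<in>G. \<Sum>f\<in>G. ?A (Some e) (Some f) * h (Some e) * h (Some f)) = fact a * (s\<^sup>2 - q)"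
    proof -
      have "(\<Sum>e\<in>G. \<Sum>f\<in>G. ?A (Some e) (Some f) * h (Some e) * h (Some f))
        = (\<Sum>e\<in>G. \<Sum>f\<in>G. fact a * (h (Some e) * h (Some f) - (if c e = c f then h (Some e) * h (Some f) else 0)))"
        by (intro sum.cong refl) (simp add: SS G c_iff)
      then show ?thesis
        by (simp add: sum_distrib_left[symmetric] sum_subtractf q_def s_def power2_eq_square sum_product)
    qed
    have "bil ?V ?A h h = ?A None None * x * x
        + (\<Sum>f\<in>G. ?A None (Some f) * x * h (Some f)) + (\<Sum>e\<in>G. ?A (Some e) None * h (Some e) * x)
        + (\<Sum>e\<in>G. \<Sum>f\<in>G. ?A (Some e) (Some f) * h (Some e) * h (Some f))"
      unfolding bil_def split by (simp add: x_def sum.distrib)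
    also have "\<dots> = fact a * ((a + 2) * (a + 1) * x\<^sup>2 + 2 * (a + 1) * x * s + (s\<^sup>2 - q))"
      unfolding NN ss by (simp add: NS SN G s_def sum_distrib_left sum_distrib_right sum.distrib power2_eq_square algebra_simps)
    finally have hh: "bil ?V ?A h h = fact a * ((a + 2) * (a + 1) * x\<^sup>2 + 2 * (a + 1) * x * s + (s\<^sup>2 - q))" .
    \<comment> \<open>Orthogonality to the direction of \<open>x\<close> determines
      \<open>s\<close>; what remains of the form is \<open>(a + 2) * x\<^sup>2 - q\<close> up to the
      factor \<open>fact a\<close>.\<close>
    assume "bil ?V ?A h (\<lambda>p. if p = None then 1 else 0) = 0"
    then have "(real a + 2) * x + s = 0"
      unfolding hv by (simp add: add.commute)
    then have s: "s = - ((real a + 2) * x)"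
      by linarith
    have "q \<ge> 0"
    proof (cases "card G = 0")
      case True
      then show ?thesis using finG by (simp add: q_def)
    next
      case False
      have "0 \<le> card G * q"
        using square_sum_le_classes[OF finG, of "\<lambda>e. h (Some e)" c] zero_le_power2[of s]
        unfolding q_def s_def by linarith
      then show ?thesis using False by (simp add: zero_le_mult_iff)
    qed
    have "s\<^sup>2 \<le> card G * q"
      using square_sum_le_classes[OF finG] by (simp add: s_def q_def)
    also have "\<dots> \<le> (a + 2) * q"
      using cardG \<open>q \<ge> 0\<close> by (intro mult_right_mono) linarith+
    finally have "(real a + 2) * ((real a + 2) * x\<^sup>2) \<le> (real a + 2) * q"
      by (simp add: s power2_eq_square algebra_simps)
    then have "(real a + 2) * x\<^sup>2 \<le> q"
      by (rule mult_left_le_imp_le) simp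
    moreover have "bil ?V ?A h h = fact a * ((real a + 2) * x\<^sup>2 - q)"
      unfolding hh s by (simp add: power2_eq_square algebra_simps)
    ultimately show "bil ?V ?A h h \<le> 0"
      by (simp add: mult_le_0_iff)
  qed
  then show ?thesis
  proof (rule lorentzian_superset)
    show "finite dirs1" by (rule finite_dirs1)
    show "?V \<subseteq> dirs1" by (auto simp: dirs1_def G_def)
    show "?A p q = 0" if "p \<in> dirs1" "q \<in> dirs1" "p \<notin> ?V \<or> q \<notin> ?V" for p q
      using that by (auto simp: dirs1_def NS SN SS)
  qed
qed

text \<open>\<open>psi n\<close> vanishes unless the order is exactly \<open>n\<close>. If one
  multiset already has size \<open>n\<close>, its factor is a constant and the Hessian is that of
  the other factor; otherwise each factor must be differentiated once.\<close>

lemma phi_Nil_lorentzian: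
  assumes n: "card ground \<le> n"
  shows "lorentzian dirs (\<lambda>p q. phi n [] (push p (push q D)))"
proof -
  obtain D1 D2 where D: "D = (D1, D2)" by (cases D)
  have psi0: "psi m X = 0" if "size X \<noteq> m" for m X using that by (simp add: psi_def)
  consider "size D1 = n" | "size D2 = n" | "size D1 \<noteq> n" "size D2 \<noteq> n" by blast
  then show ?thesis
  proof cases
    case 1
    have "lorentzian (Inr ` dirs1) (\<lambda>p q. phi n [] (push p (push q D)))"
      using lorentzian_scale[OF psi_lorentzian[OF n] psi_nonneg]
      by (intro lorentzian_image) (simp_all add: D)
    then show ?thesis
      by (rule lorentzian_superset) (use 1 finite_dirs in \<open>auto simp: dirs_def D psi0\<close>)
  next
    case 2
    have "lorentzian (Inl ` dirs1) (\<lambda>p q. phi n [] (push p (push q D)))"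
      using lorentzian_scale[OF psi_lorentzian[OF n] psi_nonneg]
      by (intro lorentzian_image) (simp_all add: D mult.commute)
    then show ?thesis
      by (rule lorentzian_superset) (use 2 finite_dirs in \<open>auto simp: dirs_def D psi0\<close>)
  next
    case 3
    show ?thesis
      unfolding dirs_def
      by (rule lorentzian_linear_product[where f = "\<lambda>p. psi n (add_mset (projl p) D1)"
            and g = "\<lambda>p. psi n (add_mset (projr p) D2)"])
        (use 3 finite_dirs1 in \<open>auto simp: D psi0\<close>)
  qed
qed

text \<open>The operator for \<open>e\<close> contracts the third derivatives with a 0-1 vector, so
  \<open>lorentzian_cubic\<close> applies: its slices are covered by the induction hypothesis, and
  connectivity comes from demotion and exchange.\<close>

lemma phi_lorentzian:
  assumes n: "card ground \<le> n" and "set S \<subseteq> ground"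
  shows "lorentzian dirs (\<lambda>p q. phi n S (push p (push q D)))"
  using assms(2)
proof (induction S arbitrary: D)
  case Nil
  show ?case by (rule phi_Nil_lorentzian[OF n])
next
  case (Cons e S)
  define g where "g p q r = phi n S (push p (push q (push r D)))" for p q r
  define v :: "'a option + 'a option \<Rightarrow> real" where "v p = (if p = Inl (Some e) \<or> p = Inr (Some e) then 1 else 0)" for p
  have g1: "g p q r = g q p r" and g2: "g p q r = g p r q" for p q r
    by (simp_all only: g_def push_commute)
  have demote: "0 < g (base p) q r" if "0 < g p q r" for p q r
    using that phi_demote[of n S p] unfolding g_def by blast
  have "lorentzian dirs (\<lambda>p q. \<Sum>r\<in>dirs. v r * g r p q)"
  proof (rule lorentzian_cubic)
    show "finite dirs" by (rule finite_dirs)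
    show "lorentzian dirs (g p)" for p
    proof -
      have "g p = (\<lambda>q r. phi n S (push q (push r (push p D))))"
        by (intro ext) (metis g_def push_commute)
      then show ?thesis using Cons by simp
    qed
    fix r :: "'a option + 'a option \<Rightarrow> real"
    assume r: "\<And>i j l. i \<in> dirs \<Longrightarrow> j \<in> dirs \<Longrightarrow> l \<in> dirs \<Longrightarrow> 0 < g i j l \<Longrightarrow> r i = r j"
    let ?x = "Inl None :: 'a option + 'a option" and ?y = "Inr None :: 'a option + 'a option"
    define act where "act i \<longleftrightarrow> (\<exists>j\<in>dirs. \<exists>l\<in>dirs. 0 < g i j l)" for i
    have xy: "?x \<in> dirs" "?y \<in> dirs" by (auto simp: dirs_def dirs1_def)
    \<comment> \<open>Demoting the other two directions of a positive triple places every active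
      direction next to derivatives in \<open>x\<close> or \<open>y\<close>.\<close>
    have base: "\<exists>b\<in>{?x, ?y}. \<exists>b'\<in>{?x, ?y}. 0 < g i b b'" if "act i" for i
    proof -
      obtain j l where "0 < g i j l" using \<open>act i\<close> unfolding act_def by blast
      then have "0 < g i (base j) (base l)"
        using demote g1 g2 by metis
      then show ?thesis
        by (auto simp: base_def split: sum.splits)
    qed
    have near: "\<exists>b\<in>{?x, ?y}. act b \<and> r i = r b" if i: "i \<in> dirs" "act i" for i
    proof -
      obtain b b' where b: "b \<in> {?x, ?y}" "b' \<in> {?x, ?y}" "0 < g i b b'"
        using base[OF i(2)] by blast
      then have "0 < g b i b'" using g1 by metis
      then show ?thesis using b i r[of i b b'] xy unfolding act_def by blast
    qed
    \<comment> \<open>Either a mixed triple links \<open>?x\<close> and \<open>?y\<close> directly,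
      or both pure triples are positive and \<open>phi_exchange\<close> yields a mixed one.\<close>
    have eq: "r ?x = r ?y" if act: "act ?x" "act ?y"
    proof -
      have "0 < g ?x ?x ?x \<or> 0 < g ?x ?y ?x \<or> 0 < g ?x ?y ?y"
        using base[OF act(1)] g2 by (metis empty_iff insert_iff)
      moreover have "0 < g ?y ?y ?y \<or> 0 < g ?x ?y ?x \<or> 0 < g ?x ?y ?y"
        using base[OF act(2)] g1 g2 by (metis empty_iff insert_iff)
      ultimately have "0 < g ?x ?y ?x \<or> 0 < g ?x ?y ?y"
        using phi_exchange[of n S D] g2 unfolding g_def by metis
      then show ?thesis using r xy by blast
    qed
    have "r i = (if act ?x then r ?x else r ?y)" if "i \<in> dirs" "act i" for i
      using near[OF that] eq by auto
    then show "\<exists>c. \<forall>i\<in>dirs. (\<exists>j\<in>dirs. \<exists>l\<in>dirs. 0 < g i j l) \<longrightarrow> r i = c"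
      unfolding act_def[symmetric] by blast
  qed (auto simp: v_def g_def phi_nonneg intro: g1[unfolded g_def] g2[unfolded g_def])
  moreover have "(\<Sum>r\<in>dirs. v r * g r p q) = phi n (e # S) (push p (push q D))" for p q
  proof -
    have "(\<Sum>r\<in>dirs. v r * g r p q) = (\<Sum>r\<in>{Inl (Some e), Inr (Some e)}. v r * g r p q)"
      using Cons.prems finite_dirs
      by (intro sum.mono_neutral_right) (auto simp: v_def dirs_def dirs1_def)
    then show ?thesis by (simp add: v_def g_def)
  qed
  ultimately show ?case by simp
qed

section \<open>Coefficients as numbers of partitions\<close>

text \<open>Leibniz rule: \<open>A\<close> collects the elements whose operator acts on the first
  factor. Distinctness of \<open>S\<close> makes such distributions subsets.\<close>

lemma phi_eq_sum:
  assumes "distinct S"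
  shows "phi n S (D, D') = (\<Sum>A\<in>Pow (set S).
    psi n (D + image_mset Some (mset_set A)) * psi n (D' + image_mset Some (mset_set (set S - A))))"
  using assms
proof (induction S arbitrary: D D')
  case Nil
  then show ?case by simp
next
  case (Cons e S)
  let ?f = "\<lambda>A. psi n (D + image_mset Some (mset_set A)) * psi n (D' + image_mset Some (mset_set (set (e # S) - A)))"
  have e: "e \<notin> set S" and S: "distinct S" using Cons.prems by auto
  have fin: "finite A" if "A \<subseteq> set S" for A using that by (rule finite_subset) simp
  have 1: "?f A = psi n (D + image_mset Some (mset_set A)) * psi n (add_mset (Some e) D' + image_mset Some (mset_set (set S - A)))"
    if "A \<in> Pow (set S)" for A
  proof -
    have "set (e # S) - A = insert e (set S - A)" using that e by auto
    then show ?thesis using e by simp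
  qed
  have 2: "?f (insert e A) = psi n (add_mset (Some e) D + image_mset Some (mset_set A)) * psi n (D' + image_mset Some (mset_set (set S - A)))"
    if "A \<in> Pow (set S)" for A
  proof -
    have "set (e # S) - insert e A = set S - A" using e by auto
    moreover have "e \<notin> A" "finite A" using that e fin by auto
    ultimately show ?thesis by simp
  qed
  have inj: "inj_on (insert e) (Pow (set S))"
    using e by (intro inj_onI) (metis Diff_insert_absorb PowD subsetD)
  have "sum ?f (Pow (set (e # S))) = sum ?f (Pow (set S)) + sum ?f (insert e ` Pow (set S))"
    unfolding list.set Pow_insert using e by (intro sum.union_disjoint) auto
  also have "\<dots> = phi n S (D, add_mset (Some e) D') + phi n S (add_mset (Some e) D, D')"
    unfolding sum.reindex[OF inj] Cons.IH[OF S] o_def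
    by (intro arg_cong2[of _ _ _ _ "(+)"] sum.cong refl) (simp_all only: 1 2)
  finally show ?case by simp
qed

lemma psi_replicate:
  assumes "finite A"
  shows "psi n (replicate_mset a None + image_mset Some (mset_set A)) = (if a + card A = n \<and> indep A then fact a else 0)"
proof -
  have "elts (replicate_mset a None + image_mset Some (mset_set A)) = A"
    using assms by (auto simp: elts_def)
  moreover have "count (image_mset Some (mset_set A)) None = 0"
    by (auto simp: count_eq_zero_iff)
  moreover have "count (image_mset Some (mset_set A)) (Some e) \<le> 1" for e
    by (simp add: image_mset_mset_set count_mset_set')
  ultimately show ?thesis
    by (simp add: psi_def)
qed

text \<open>Only sets of size \<open>n - a = i\<close> survive in the first factor; the factorials
  come from differentiating the remaining powers of \<open>x\<close> and \<open>y\<close>.\<close>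

lemma phi_eq_num_indep_partitions:
  assumes "distinct S" "set S = ground" "a + i = n" "b + j = n" "i + j = card ground"
  shows "phi n S (replicate_mset a None, replicate_mset b None)
    = fact a * fact b * real (num_indep_partitions ground indep i j)"
proof -
  let ?P = "\<lambda>A. indep A \<and> indep (ground - A) \<and> card A = i \<and> card (ground - A) = j"
  have fin: "finite A" if "A \<subseteq> ground" for A
    using that ground_finite by (rule finite_subset)
  have "phi n S (replicate_mset a None, replicate_mset b None) = (\<Sum>A\<in>Pow ground. if ?P A then fact a * fact b else 0)"
    unfolding phi_eq_sum[OF assms(1)] assms(2)
    by (intro sum.cong refl) (use assms fin in \<open>auto simp: psi_replicate ground_finite\<close>)
  also have "\<dots> = fact a * fact b * real (card {A \<in> Pow ground. ?P A})"
    using ground_finite by (simp add: sum.inter_filter[symmetric])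
  also have "card {A \<in> Pow ground. ?P A} = num_indep_partitions ground indep i j"
    unfolding num_indep_partitions_def
  proof (rule bij_betw_same_card)
    show "bij_betw (\<lambda>A. (A, ground - A)) {A \<in> Pow ground. ?P A} (indep_partitions ground indep i j)"
    proof (rule bij_betw_byWitness[where f' = fst])
      have "B = ground - A" if "A \<union> B = ground" "A \<inter> B = {}" for A B
        using that by blast
      then show "\<forall>x\<in>indep_partitions ground indep i j. (fst x, ground - fst x) = x"
        and "fst ` indep_partitions ground indep i j \<subseteq> {A \<in> Pow ground. ?P A}"
        unfolding indep_partitions_def by force+
    qed (auto simp: indep_partitions_def)
  qed
  finally show ?thesis .
qed

end

section \<open>Symmetry of the counts and the final inequality\<close>

lemma num_indep_partitions_commute:
  "num_indep_partitions Y indep i j = num_indep_partitions Y indep j i"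
  unfolding num_indep_partitions_def
proof (rule bij_betw_same_card)
  show "bij_betw prod.swap (indep_partitions Y indep i j) (indep_partitions Y indep j i)"
    by (rule bij_betw_byWitness[where f' = prod.swap]) (auto simp: indep_partitions_def)
qed

theorem theorem3p2:
  fixes E :: "'a set" and indep :: "'a set \<Rightarrow> bool" and k :: nat
  assumes "matroid E indep"
    and "k \<ge> 1"
    and "card E = 2 * k"
  shows "real (num_indep_partitions E indep k k)
           \<ge> (1 + 1 / real k) * real (num_indep_partitions E indep (k - 1) (k + 1))"
proof -
  interpret matroid E indep by fact
  define m where "m = k - 1"
  have k: "k = Suc m" using assms(2) by (simp add: m_def)
  define X where "X = num_indep_partitions E indep k k"
  define Y where "Y = num_indep_partitions E indep (k - 1) (k + 1)"
  obtain S where S: "distinct S" "set S = E"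
    using finite_distinct_list[OF ground_finite] by blast
  \<comment> \<open>Differentiating \<open>m\<close> times in each of \<open>x\<close> and
    \<open>y\<close> leaves a binary quadratic form, with Hessian \<open>?A\<close>.\<close>
  let ?r = "replicate_mset m (None :: 'a option)"
  let ?A = "\<lambda>p q. phi (2 * k) S (push p (push q (?r, ?r)))"
  let ?x = "Inl None :: 'a option + 'a option" and ?y = "Inr None :: 'a option + 'a option"
  \<comment> \<open>A set of size \<open>b\<close> leaves the power \<open>a\<close> of
    \<open>x\<close>, hence the swapped indices of the count.\<close>
  have count: "phi (2 * k) S (replicate_mset a None, replicate_mset b None)
      = fact a * fact b * real (num_indep_partitions E indep b a)" if "a + b = 2 * k" for a b
    using that S assms(3) by (intro phi_eq_num_indep_partitions) auto
  \<comment> \<open>Symmetry makes the diagonal entries equal, so the determinant inequality below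
    compares two squares.\<close>
  have xx: "?A ?x ?x = fact (Suc k) * fact m * real Y" and yy: "?A ?y ?y = fact (Suc k) * fact m * real Y"
    using count[of "Suc k" m] count[of m "Suc k"] num_indep_partitions_commute[of E indep m]
    by (simp_all add: k Y_def)
  have xy: "?A ?x ?y = fact k * fact k * real X" and yx: "?A ?y ?x = fact k * fact k * real X"
    using count[of k k] by (simp_all add: k X_def)
  have "lorentzian {?x, ?y} ?A"
    by (rule lorentzian_subset[OF phi_lorentzian]) (use S assms(3) finite_dirs in \<open>auto simp: dirs_def dirs1_def\<close>)
  moreover have bil: "bil {?x, ?y} ?A u p = ?A ?x ?x * u ?x * p ?x + ?A ?x ?y * u ?x * p ?y
      + (?A ?y ?x * u ?y * p ?x + ?A ?y ?y * u ?y * p ?y)" for u p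
    by (simp add: bil_def)
  \<comment> \<open>Evaluation at the two coordinate vectors: the determinant of the Hessian is
    nonpositive.\<close>
  ultimately have "0 < ?A ?y ?y \<longrightarrow> ?A ?x ?x * ?A ?y ?y \<le> (?A ?x ?y)\<^sup>2"
    unfolding lorentzian_def bil
    by - (drule spec[of _ "\<lambda>p. if p = ?x then 1 else 0"], drule spec[of _ "\<lambda>p. if p = ?y then 1 else 0"], simp)
  then have sq: "0 < fact (Suc k) * fact m * real Y \<longrightarrow>
      (fact (Suc k) * fact m * real Y)\<^sup>2 \<le> (fact k * fact k * real X)\<^sup>2"
    unfolding xx yy xy power2_eq_square .
  have "fact (Suc k) * fact m * real Y \<le> fact k * fact k * real X"
  proof (cases "0 < fact (Suc k) * fact m * real Y")
    case True
    then show ?thesis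
      using sq by (auto intro: power2_le_imp_le)
  next
    case False
    have "0 \<le> fact k * fact k * real X" by simp
    with False show ?thesis by linarith
  qed
  \<comment> \<open>Cancelling the common factor \<open>fact k * fact m\<close> leaves the ratio of
    \<open>k + 1\<close> to \<open>k\<close>.\<close>
  moreover have "fact (Suc k) * fact m * real Y = (fact k * fact m) * ((k + 1) * real Y)"
    by (simp add: algebra_simps)
  moreover have "fact k * fact k * real X = (fact k * fact m) * (k * real X)"
    by (simp add: k algebra_simps)
  ultimately have "(k + 1) * real Y \<le> k * real X"
    by (simp add: mult_le_cancel_left)
  then show ?thesis
    using assms(2) unfolding X_def[symmetric] Y_def[symmetric] by (simp add: field_simps)
qed

end
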